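(* For any unimodal range map $\delta$, the minimal generating set $\mathfrak{G}_\delta=\{\mathsf{E}_w:w\in\mathcal{P}_\delta\}$ of the operad $\mathbf{Cl}_\delta$ is finite if and only if $\delta$ is $1$-dominated.
   Context: $\mathbb{N}=\{0,1,2,\dots\}$ and $\mathbb{K}$ is a field of characteristic zero. A range map is a map $\delta:\mathbb{N}\setminus\{0\}\to\mathbb{N}$. It is unimodal if there are no $1\le i_1<i_2<i_3$ with $\delta(i_1)>\delta(i_2)<\delta(i_3)$. It is $1$-dominated if there is a $k\ge1$ such that $\delta(1)\ge\delta(k')$ for all $k'\ge k$. For a word $w$ on $\mathbb{N}$, $\ell(w)$ is its length, $w(i)$ its $i$-th letter, $\epsilon$ is the empty word. A $\delta$-cliff is a word $w$ on $\mathbb{N}$ with $0\le w(i)\le\delta(i)$ for all $i$; its size is $|w|:=\ell(w)+1$; $\mathsf{Cl}_\delta$ is the graded set of all $\delta$-cliffs. For words $u,v$ and $1\le i\le|u|$, $u\,\square_i\,v:=u(1)\cdots u(i-1)\;v\;u(i)\cdots u(\ell(u))$. For $\delta$ unimodal, $\mathbf{Cl}_\delta$ is the nonsymmetric operad over $\mathbb{K}$ with basis $\{\mathsf{E}_w:w\in\mathsf{Cl}_\delta\}$ ($\mathsf{E}_w$ of arity $|w|$), partial compositions $\mathsf{E}_u\circ_i\mathsf{E}_v=\mathsf{E}_{u\,\square_i\,v}$ if $u\,\square_i\,v\in\mathsf{Cl}_\delta$ and $\mathsf{E}_u\circ_i\mathsf{E}_v=0$ otherwise, and unit $\mathsf{E}_\epsilon$.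 A nonempty $\delta$-cliff $w$ is $\delta$-prime if $w=u\,\square_i\,v$ with $u,v\in\mathsf{Cl}_\delta$ and $1\le i\le|u|$ implies $(u,v)\in\{(w,\epsilon),(\epsilon,w)\}$. $\mathcal{P}_\delta$ is the set of all $\delta$-prime $\delta$-cliffs. The set $\mathfrak{G}_\delta$ generates $\mathbf{Cl}_\delta$ as an operad and no proper subset of it does. *)

theory Defs
  imports Complex_Main "HOL-Library.Poly_Mapping"
begin

section \<open>Nonsymmetric operads\<close>

text \<open>The components of an operad are subspaces of one ambient vector space, which lets a single
  function serve as partial composition in all arities.\<close>

record ('k, 'a) operad_data =
  component :: "nat \<Rightarrow> 'a set"
  scale :: "'k \<Rightarrow> 'a \<Rightarrow> 'a"
  pcomp :: "'a \<Rightarrow> nat \<Rightarrow> 'a \<Rightarrow> 'a"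
  op_unit :: 'a

locale ns_operad =
  fixes P :: "('k::field, 'a::ab_group_add) operad_data"
  assumes vector_space: "vector_space (scale P)"
    and component_subspace: "module.subspace (scale P) (component P n)"
    and unit_closed: "op_unit P \<in> component P 1"
    and pcomp_closed:
      "\<lbrakk>x \<in> component P n; y \<in> component P m; 1 \<le> i; i \<le> n\<rbrakk>
        \<Longrightarrow> pcomp P x i y \<in> component P (n + m - 1)"
    and pcomp_add_left:
      "\<lbrakk>x \<in> component P n; x' \<in> component P n; y \<in> component P m; 1 \<le> i; i \<le> n\<rbrakk>
        \<Longrightarrow> pcomp P (x + x') i y = pcomp P x i y + pcomp P x' i y"
    and pcomp_add_right:
      "\<lbrakk>x \<in> component P n; y \<in> component P m; y' \<in> component P m; 1 \<le> i; i \<le> n\<rbrakk>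
        \<Longrightarrow> pcomp P x i (y + y') = pcomp P x i y + pcomp P x i y'"
    and pcomp_scale_left:
      "\<lbrakk>x \<in> component P n; y \<in> component P m; 1 \<le> i; i \<le> n\<rbrakk>
        \<Longrightarrow> pcomp P (scale P c x) i y = scale P c (pcomp P x i y)"
    and pcomp_scale_right:
      "\<lbrakk>x \<in> component P n; y \<in> component P m; 1 \<le> i; i \<le> n\<rbrakk>
        \<Longrightarrow> pcomp P x i (scale P c y) = scale P c (pcomp P x i y)"
    and unit_left: "x \<in> component P n \<Longrightarrow> pcomp P (op_unit P) 1 x = x"
    and unit_right: "\<lbrakk>x \<in> component P n; 1 \<le> i; i \<le> n\<rbrakk> \<Longrightarrow> pcomp P x i (op_unit P) = x"
    and assoc_nested:
      "\<lbrakk>x \<in> component P n; y \<in> component P m; z \<in> component P p; 1 \<le> i; i \<le> n; 1 \<le> j; j \<le> m\<rbrakk>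
        \<Longrightarrow> pcomp P (pcomp P x i y) (i + j - 1) z = pcomp P x i (pcomp P y j z)"
    and assoc_disjoint:
      "\<lbrakk>x \<in> component P n; y \<in> component P m; z \<in> component P p; 1 \<le> i; i < j; j \<le> n\<rbrakk>
        \<Longrightarrow> pcomp P (pcomp P x i y) (j + m - 1) z = pcomp P (pcomp P x j z) i y"

text \<open>\<open>generated P S n x\<close>: \<open>x\<close> is an element of arity \<open>n\<close> of the smallest suboperad of \<open>P\<close>
  containing \<open>S\<close>.\<close>

inductive generated :: "('k, 'a::ab_group_add) operad_data \<Rightarrow> 'a set \<Rightarrow> nat \<Rightarrow> 'a \<Rightarrow> bool"
  for P :: "('k, 'a) operad_data" and S :: "'a set" where
  gen: "\<lbrakk>x \<in> S; x \<in> component P n\<rbrakk> \<Longrightarrow> generated P S n x"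
| unit: "generated P S 1 (op_unit P)"
| zero: "generated P S n 0"
| add: "\<lbrakk>generated P S n x; generated P S n y\<rbrakk> \<Longrightarrow> generated P S n (x + y)"
| scale: "generated P S n x \<Longrightarrow> generated P S n (scale P c x)"
| pcomp: "\<lbrakk>generated P S n x; generated P S m y; 1 \<le> i; i \<le> n\<rbrakk>
    \<Longrightarrow> generated P S (n + m - 1) (pcomp P x i y)"

definition generates :: "('k, 'a::ab_group_add) operad_data \<Rightarrow> 'a set \<Rightarrow> bool" where
  "generates P S \<longleftrightarrow>
     S \<subseteq> (\<Union>n. component P n) \<and> (\<forall>n. {x. generated P S n x} = component P n)"

definition minimal_generating_set :: "('k, 'a::ab_group_add) operad_data \<Rightarrow> 'a set \<Rightarrow> bool" where
  "minimal_generating_set P S \<longleftrightarrow> generates P S \<and> (\<forall>T. T \<subset> S \<longrightarrow> \<not> generates P T)"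

section \<open>Range maps and cliffs\<close>

text \<open>A range map is a function \<open>\<delta> :: nat \<Rightarrow> nat\<close> of which only the values at
  positive arguments are ever used.\<close>

definition unimodal :: "(nat \<Rightarrow> nat) \<Rightarrow> bool" where
  "unimodal \<delta> \<longleftrightarrow>
     \<not> (\<exists>i1 i2 i3. 1 \<le> i1 \<and> i1 < i2 \<and> i2 < i3 \<and> \<delta> i1 > \<delta> i2 \<and> \<delta> i2 < \<delta> i3)"

definition one_dominated :: "(nat \<Rightarrow> nat) \<Rightarrow> bool" where
  "one_dominated \<delta> \<longleftrightarrow> (\<exists>k\<ge>1. \<forall>k'\<ge>k. \<delta> 1 \<ge> \<delta> k')"

text \<open>The letters of a word are numbered from 1, so the \<open>i\<close>-th letter is \<open>w ! (i - 1)\<close>.\<close>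

definition cliffs :: "(nat \<Rightarrow> nat) \<Rightarrow> nat list set" where
  "cliffs \<delta> = {w. \<forall>i. 1 \<le> i \<and> i \<le> length w \<longrightarrow> w ! (i - 1) \<le> \<delta> i}"

definition cliff_size :: "nat list \<Rightarrow> nat" where
  "cliff_size w = length w + 1"

definition word_insert :: "nat list \<Rightarrow> nat \<Rightarrow> nat list \<Rightarrow> nat list" where
  "word_insert u i v = take (i - 1) u @ v @ drop (i - 1) u"

definition primes :: "(nat \<Rightarrow> nat) \<Rightarrow> nat list set" where
  "primes \<delta> = {w \<in> cliffs \<delta>. w \<noteq> [] \<and>
     (\<forall>u\<in>cliffs \<delta>. \<forall>v\<in>cliffs \<delta>. \<forall>i. 1 \<le> i \<and> i \<le> cliff_size u \<and> w = word_insert u i v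
        \<longrightarrow> (u, v) \<in> {(w, []), ([], w)})}"

section \<open>The operad of cliffs\<close>

text \<open>Elements of the operad are finitely supported functions from words to the field.\<close>

definition E :: "nat list \<Rightarrow> (nat list \<Rightarrow>\<^sub>0 'k::field_char_0)" where
  "E w = Poly_Mapping.single w 1"

definition cliff_comp_basis ::
    "(nat \<Rightarrow> nat) \<Rightarrow> nat list \<Rightarrow> nat \<Rightarrow> nat list \<Rightarrow> (nat list \<Rightarrow>\<^sub>0 'k::field_char_0)" where
  "cliff_comp_basis \<delta> u i v = (if word_insert u i v \<in> cliffs \<delta> then E (word_insert u i v) else 0)"

definition cliff_scale :: "'k::field_char_0 \<Rightarrow> (nat list \<Rightarrow>\<^sub>0 'k) \<Rightarrow> (nat list \<Rightarrow>\<^sub>0 'k)" where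
  "cliff_scale c x = Poly_Mapping.map ((*) c) x"

definition Cl :: "(nat \<Rightarrow> nat) \<Rightarrow> ('k::field_char_0, nat list \<Rightarrow>\<^sub>0 'k) operad_data" where
  "Cl \<delta> = \<lparr>
     component = (\<lambda>n. {x. Poly_Mapping.keys x \<subseteq> {w \<in> cliffs \<delta>. cliff_size w = n}}),
     scale = cliff_scale,
     pcomp = (\<lambda>x i y. \<Sum>u\<in>Poly_Mapping.keys x. \<Sum>v\<in>Poly_Mapping.keys y.
        cliff_scale (Poly_Mapping.lookup x u * Poly_Mapping.lookup y v) (cliff_comp_basis \<delta> u i v)),
     op_unit = E []\<rparr>"

definition \<GG> :: "(nat \<Rightarrow> nat) \<Rightarrow> (nat list \<Rightarrow>\<^sub>0 'k::field_char_0) set" where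
  "\<GG> \<delta> = E ` primes \<delta>"

subsection \<open>The operad axioms\<close>

lemma lookup_cliff_scale [simp]:
  "Poly_Mapping.lookup (cliff_scale c x) w = c * Poly_Mapping.lookup x w"
  by (simp add: cliff_scale_def Poly_Mapping.map.rep_eq when_def)

lemma vector_space_cliff_scale: "vector_space (cliff_scale :: 'k::field_char_0 \<Rightarrow> _)"
  by unfold_locales (auto intro!: poly_mapping_eqI simp: lookup_add algebra_simps)

lemma keys_cliff_scale: "Poly_Mapping.keys (cliff_scale c x) \<subseteq> Poly_Mapping.keys x"
  by (auto simp: in_keys_iff)

lemma cliff_scale_zero_right [simp]: "cliff_scale c 0 = 0"
  by (auto intro!: poly_mapping_eqI)

lemma cliff_scale_zero_left [simp]: "cliff_scale 0 x = 0"
  by (auto intro!: poly_mapping_eqI)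

lemma cliff_scale_add_left: "cliff_scale (a + b) x = cliff_scale a x + cliff_scale b x"
  by (auto intro!: poly_mapping_eqI simp: lookup_add algebra_simps)

lemma cliff_scale_scale: "cliff_scale a (cliff_scale b x) = cliff_scale (a * b) x"
  by (auto intro!: poly_mapping_eqI simp: algebra_simps)

lemma cliff_scale_sum: "cliff_scale a (sum f A) = (\<Sum>x\<in>A. cliff_scale a (f x))"
  by (auto intro!: poly_mapping_eqI simp: lookup_sum sum_distrib_left)

lemma cliff_scale_E: "cliff_scale c (E w) = Poly_Mapping.single w c"
  by (auto intro!: poly_mapping_eqI simp: E_def lookup_single when_def)

lemma pcomp_Cl_superset:
  assumes "finite U" "finite V" "Poly_Mapping.keys x \<subseteq> U" "Poly_Mapping.keys y \<subseteq> V"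
  shows "pcomp (Cl \<delta>) x i y = (\<Sum>u\<in>U. \<Sum>v\<in>V.
    cliff_scale (Poly_Mapping.lookup x u * Poly_Mapping.lookup y v) (cliff_comp_basis \<delta> u i v))"
proof -
  have "pcomp (Cl \<delta>) x i y = (\<Sum>u\<in>Poly_Mapping.keys x. \<Sum>v\<in>V.
    cliff_scale (Poly_Mapping.lookup x u * Poly_Mapping.lookup y v) (cliff_comp_basis \<delta> u i v))"
    unfolding Cl_def operad_data.simps
    by (intro sum.cong refl sum.mono_neutral_left) (use assms in \<open>auto simp: in_keys_iff\<close>)
  also have "\<dots> = (\<Sum>u\<in>U. \<Sum>v\<in>V.
    cliff_scale (Poly_Mapping.lookup x u * Poly_Mapping.lookup y v) (cliff_comp_basis \<delta> u i v))"
    by (intro sum.mono_neutral_left) (use assms in \<open>auto simp: in_keys_iff\<close>)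
  finally show ?thesis .
qed

lemma pcomp_Cl_add_left:
  "pcomp (Cl \<delta>) (x + x') i y = pcomp (Cl \<delta>) x i y + pcomp (Cl \<delta>) x' i y"
proof -
  let ?U = "Poly_Mapping.keys x \<union> Poly_Mapping.keys x'"
  note eq = pcomp_Cl_superset[of ?U "Poly_Mapping.keys y" _ y \<delta> i]
  show ?thesis
    by (subst (1 2 3) eq)
      (auto simp: lookup_add sum.distrib distrib_right cliff_scale_add_left
        dest: subsetD[OF Poly_Mapping.keys_add])
qed

lemma pcomp_Cl_add_right:
  "pcomp (Cl \<delta>) x i (y + y') = pcomp (Cl \<delta>) x i y + pcomp (Cl \<delta>) x i y'"
proof -
  let ?V = "Poly_Mapping.keys y \<union> Poly_Mapping.keys y'"
  note eq = pcomp_Cl_superset[of "Poly_Mapping.keys x" ?V x _ \<delta> i]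
  show ?thesis
    by (subst (1 2 3) eq)
      (auto simp: lookup_add sum.distrib distrib_left cliff_scale_add_left
        dest: subsetD[OF Poly_Mapping.keys_add])
qed

lemma pcomp_Cl_scale_left:
  "pcomp (Cl \<delta>) (cliff_scale c x) i y = cliff_scale c (pcomp (Cl \<delta>) x i y)"
proof -
  note eq = pcomp_Cl_superset[of "Poly_Mapping.keys x" "Poly_Mapping.keys y" _ y \<delta> i]
  show ?thesis
    by (subst (1 2) eq)
      (auto simp: cliff_scale_sum cliff_scale_scale mult.assoc
        dest: subsetD[OF keys_cliff_scale])
qed

lemma pcomp_Cl_scale_right:
  "pcomp (Cl \<delta>) x i (cliff_scale c y) = cliff_scale c (pcomp (Cl \<delta>) x i y)"
proof -
  note eq = pcomp_Cl_superset[of "Poly_Mapping.keys x" "Poly_Mapping.keys y" x _ \<delta> i]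
  show ?thesis
    by (subst (1 2) eq)
      (auto simp: cliff_scale_sum cliff_scale_scale mult.assoc mult.left_commute[of _ c]
        dest: subsetD[OF keys_cliff_scale])
qed

lemma pcomp_Cl_zero [simp]: "pcomp (Cl \<delta>) 0 i y = 0" "pcomp (Cl \<delta>) x i 0 = 0"
  by (simp_all add: Cl_def)

lemma pcomp_Cl_E: "pcomp (Cl \<delta>) (E u) i (E v) = cliff_comp_basis \<delta> u i v"
proof -
  have "cliff_scale 1 z = z" for z :: "nat list \<Rightarrow>\<^sub>0 'k::field_char_0"
    by (auto intro!: poly_mapping_eqI)
  then show ?thesis
    by (simp add: E_def pcomp_Cl_superset[of "{u}" "{v}"])
qed

lemma cliff_span_induct [consumes 1, case_names zero E add]:
  fixes x :: "nat list \<Rightarrow>\<^sub>0 'k::field_char_0"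
  assumes "Poly_Mapping.keys x \<subseteq> A" and zero: "P 0"
    and E: "\<And>w c. w \<in> A \<Longrightarrow> P (cliff_scale c (E w))"
    and add: "\<And>y z. P y \<Longrightarrow> P z \<Longrightarrow> P (y + z)"
  shows "P x"
proof -
  have "P (\<Sum>w\<in>F. cliff_scale (Poly_Mapping.lookup x w) (E w))" if "finite F" "F \<subseteq> A" for F
    using that by (induction F rule: finite_induct) (auto intro: zero E add)
  then have "P (\<Sum>w\<in>Poly_Mapping.keys x. cliff_scale (Poly_Mapping.lookup x w) (E w))"
    using assms(1) by simp
  also have "(\<Sum>w\<in>Poly_Mapping.keys x. cliff_scale (Poly_Mapping.lookup x w) (E w)) = x"
    by (rule poly_mapping_eqI)
      (simp add: lookup_sum cliff_scale_E lookup_single when_def sum.delta in_keys_iff)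
  finally show ?thesis .
qed

definition fits :: "(nat \<Rightarrow> nat) \<Rightarrow> nat \<Rightarrow> nat list \<Rightarrow> bool" where
  "fits \<delta> s w \<longleftrightarrow> (\<forall>k<length w. w ! k \<le> \<delta> (s + k + 1))"

lemma cliffs_iff_fits: "w \<in> cliffs \<delta> \<longleftrightarrow> fits \<delta> 0 w"
proof
  assume "w \<in> cliffs \<delta>"
  then have "\<And>i. 1 \<le> i \<Longrightarrow> i \<le> length w \<Longrightarrow> w ! (i - 1) \<le> \<delta> i"
    by (simp add: cliffs_def)
  from this[of "Suc _"] show "fits \<delta> 0 w"
    by (auto simp: fits_def)
next
  assume *: "fits \<delta> 0 w"
  have "w ! (i - 1) \<le> \<delta> i" if "1 \<le> i" "i \<le> length w" for i
    using * that by (cases i) (auto simp: fits_def)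
  then show "w \<in> cliffs \<delta>"
    by (simp add: cliffs_def)
qed

lemma fits_append [simp]: "fits \<delta> s (u @ v) \<longleftrightarrow> fits \<delta> s u \<and> fits \<delta> (s + length u) v"
proof -
  have "fits \<delta> s u \<and> fits \<delta> (s + length u) v" if "fits \<delta> s (u @ v)"
  proof -
    have *: "(u @ v) ! k \<le> \<delta> (s + k + 1)" if "k < length u + length v" for k
      using \<open>fits \<delta> s (u @ v)\<close> that by (simp add: fits_def)
    have "fits \<delta> s u"
      unfolding fits_def using * by (metis nth_append trans_less_add1)
    moreover have "fits \<delta> (s + length u) v"
      unfolding fits_def
      using *[of "length u + _"] by (auto simp: nth_append add.assoc)
    ultimately show ?thesis by simp
  qed
  moreover have "fits \<delta> s (u @ v)" if "fits \<delta> s u" "fits \<delta> (s + length u) v"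
    unfolding fits_def
  proof (intro allI impI)
    fix k
    assume k: "k < length (u @ v)"
    show "(u @ v) ! k \<le> \<delta> (s + k + 1)"
    proof (cases "k < length u")
      case True
      then show ?thesis
        using that(1) by (simp add: fits_def nth_append)
    next
      case False
      then obtain l where "k = length u + l"
        using le_Suc_ex not_less by blast
      then show ?thesis
        using that(2) k by (simp add: fits_def nth_append add.assoc)
    qed
  qed
  ultimately show ?thesis by blast
qed

lemma fits_between:
  assumes "unimodal \<delta>" "fits \<delta> p w" "fits \<delta> r w" "p \<le> q" "q \<le> r"
  shows "fits \<delta> q w"
  unfolding fits_def
proof (intro allI impI, rule ccontr)
  fix k
  assume k: "k < length w" "\<not> w ! k \<le> \<delta> (q + k + 1)"
  have "w ! k \<le> \<delta> (p + k + 1)" "w ! k \<le> \<delta> (r + k + 1)"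
    using assms k by (auto simp: fits_def)
  with k have "\<delta> (p + k + 1) > \<delta> (q + k + 1)" "\<delta> (q + k + 1) < \<delta> (r + k + 1)"
    by linarith+
  moreover from this have "p \<noteq> q" "q \<noteq> r"
    by auto
  ultimately show False
    using assms(1,4,5) unfolding unimodal_def
    by (metis add_less_mono1 le_add2 le_neq_implies_less)
qed

lemma word_insert_split:
  assumes "1 \<le> i" "i \<le> cliff_size u"
  obtains u1 u2 where "u = u1 @ u2" "i = length u1 + 1"
proof
  show "u = take (i - 1) u @ drop (i - 1) u" "i = length (take (i - 1) u) + 1"
    using assms by (auto simp: cliff_size_def)
qed

lemma word_insert_append [simp]:
  "word_insert (u1 @ u2) (Suc (length u1)) v = u1 @ v @ u2"
  by (simp add: word_insert_def)

lemma assoc_nested_basis: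
  assumes "unimodal \<delta>" "u \<in> cliffs \<delta>" "v \<in> cliffs \<delta>" "w \<in> cliffs \<delta>"
    and "1 \<le> i" "i \<le> cliff_size u" "1 \<le> j" "j \<le> cliff_size v"
  shows "pcomp (Cl \<delta>) (cliff_comp_basis \<delta> u i v) (i + j - 1) (E w :: nat list \<Rightarrow>\<^sub>0 'k::field_char_0) =
    pcomp (Cl \<delta>) (E u) i (cliff_comp_basis \<delta> v j w)"
proof -
  obtain u1 u2 where u: "u = u1 @ u2" "i = length u1 + 1"
    using word_insert_split assms by blast
  obtain v1 v2 where v: "v = v1 @ v2" "j = length v1 + 1"
    using word_insert_split assms by blast
  let ?t = "u1 @ v1 @ w @ v2 @ u2"
  have *: "word_insert (u1 @ v1 @ v2 @ u2) (Suc (length u1 + length v1)) w = ?t"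
    using word_insert_append[of "u1 @ v1" "v2 @ u2" w] by simp
  note between = fits_between[OF assms(1)]
  have "word_insert u i v \<in> cliffs \<delta>" "word_insert v j w \<in> cliffs \<delta>" if "?t \<in> cliffs \<delta>"
    using assms(2-4) that unfolding u v
    by (auto simp: cliffs_iff_fits
        intro: between[of "length v1" v2 "length u1 + length v1 + length w"]
          between[of "length u1" u2 "length u1 + length v1 + length w + length v2"]
          between[of 0 w "length u1 + length v1"])
  then show ?thesis
    using * unfolding u v by (auto simp: cliff_comp_basis_def pcomp_Cl_E)
qed

lemma assoc_disjoint_basis:
  assumes "unimodal \<delta>" "u \<in> cliffs \<delta>" "v \<in> cliffs \<delta>" "w \<in> cliffs \<delta>"
    and "1 \<le> i" "i < j" "j \<le> cliff_size u"
  shows "pcomp (Cl \<delta>) (cliff_comp_basis \<delta> u i v) (j + cliff_size v - 1) (E w :: nat list \<Rightarrow>\<^sub>0 'k::field_char_0) =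
    pcomp (Cl \<delta>) (cliff_comp_basis \<delta> u j w) i (E v)"
proof -
  obtain u' u3 where u': "u = u' @ u3" "j = length u' + 1"
    using word_insert_split[of j u] assms by auto
  then obtain u1 u2 where u: "u' = u1 @ u2" "i = length u1 + 1"
    using word_insert_split[of i u'] assms by (auto simp: cliff_size_def)
  let ?t = "u1 @ v @ u2 @ w @ u3"
  have *: "word_insert (u1 @ v @ u2 @ u3) (length u1 + (length u2 + (length v + 1))) w = ?t"
    using word_insert_append[of "u1 @ v @ u2" u3 w] by (simp add: ac_simps)
  have **: "word_insert (u1 @ u2 @ u3) (Suc (length u1 + length u2)) z = u1 @ u2 @ z @ u3" for z
    using word_insert_append[of "u1 @ u2" u3 z] by simp
  note between = fits_between[OF assms(1)]
  have "word_insert u i v \<in> cliffs \<delta>" "word_insert u j w \<in> cliffs \<delta>" if "?t \<in> cliffs \<delta>"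
    using assms(2-4) that unfolding u' u
    by (auto simp: cliffs_iff_fits **
        intro: between[of "length u1" u2 "length u1 + length v"]
          between[of "length u1 + length u2" u3 "length u1 + length v + length u2 + length w"]
          between[of 0 w "length u1 + length v + length u2"])
  then show ?thesis
    using * ** unfolding u' u
    by (auto simp: cliff_comp_basis_def pcomp_Cl_E cliff_size_def add_ac)
qed

lemma component_Cl [simp]:
  "component (Cl \<delta>) n = {x. Poly_Mapping.keys x \<subseteq> {w \<in> cliffs \<delta>. cliff_size w = n}}"
  by (simp add: Cl_def)

lemma scale_Cl [simp]: "scale (Cl \<delta>) = cliff_scale"
  by (simp add: Cl_def)

lemma op_unit_Cl [simp]: "op_unit (Cl \<delta>) = E []"
  by (simp add: Cl_def)

lemma keys_E [simp]: "Poly_Mapping.keys (E w :: _ \<Rightarrow>\<^sub>0 'k::field_char_0) = {w}"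
  by (simp add: E_def)

lemma keys_cliff_comp_basis:
  assumes "1 \<le> i" "i \<le> cliff_size u"
  shows "Poly_Mapping.keys (cliff_comp_basis \<delta> u i v :: _ \<Rightarrow>\<^sub>0 'k::field_char_0) \<subseteq>
    {w \<in> cliffs \<delta>. cliff_size w = cliff_size u + cliff_size v - 1}"
proof -
  obtain u1 u2 where "u = u1 @ u2" "i = length u1 + 1"
    using word_insert_split assms by blast
  then show ?thesis
    by (auto simp: cliff_comp_basis_def cliff_size_def)
qed

theorem ns_operad_Cl:
  assumes "unimodal \<delta>"
  shows "ns_operad (Cl \<delta> :: ('k::field_char_0, nat list \<Rightarrow>\<^sub>0 'k) operad_data)"
proof (rule ns_operad.intro)
  let ?P = "Cl \<delta> :: ('k, nat list \<Rightarrow>\<^sub>0 'k) operad_data"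
  interpret vs: vector_space "cliff_scale :: 'k \<Rightarrow> _"
    by (rule vector_space_cliff_scale)
  show "vector_space (scale ?P)"
    by (simp add: vector_space_cliff_scale)
  show sub: "module.subspace (scale ?P) (component ?P n)" for n
    unfolding scale_Cl component_Cl vs.subspace_def
    using Poly_Mapping.keys_add keys_cliff_scale by fastforce
  show "op_unit ?P \<in> component ?P 1"
    by (simp add: cliffs_def cliff_size_def)
  fix x x' y y' z :: "nat list \<Rightarrow>\<^sub>0 'k" and n m p i j :: nat and c :: 'k
  show "pcomp ?P (x + x') i y = pcomp ?P x i y + pcomp ?P x' i y"
    "pcomp ?P x i (y + y') = pcomp ?P x i y + pcomp ?P x i y'"
    "pcomp ?P (scale ?P c x) i y = scale ?P c (pcomp ?P x i y)"
    "pcomp ?P x i (scale ?P c y) = scale ?P c (pcomp ?P x i y)"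
    by (simp_all add: pcomp_Cl_add_left pcomp_Cl_add_right pcomp_Cl_scale_left pcomp_Cl_scale_right)
  note bilinear = pcomp_Cl_add_left pcomp_Cl_add_right pcomp_Cl_scale_left pcomp_Cl_scale_right
  show "pcomp ?P x i y \<in> component ?P (n + m - 1)"
    if "x \<in> component ?P n" "y \<in> component ?P m" "1 \<le> i" "i \<le> n"
  proof -
    let ?S = "component ?P (n + m - 1)"
    have add: "a + b \<in> ?S" if "a \<in> ?S" "b \<in> ?S" for a b
      using vs.subspace_add sub that unfolding scale_Cl by blast
    have scl: "cliff_scale c a \<in> ?S" if "a \<in> ?S" for a c
      using vs.subspace_scale sub that unfolding scale_Cl by blast
    have zero: "0 \<in> ?S" by simp
    have basis: "cliff_comp_basis \<delta> u i v \<in> ?S"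
      if "u \<in> {w \<in> cliffs \<delta>. cliff_size w = n}" "v \<in> {w \<in> cliffs \<delta>. cliff_size w = m}" for u v
      using keys_cliff_comp_basis[of i u \<delta> v] that \<open>1 \<le> i\<close> \<open>i \<le> n\<close> by auto
    have y: "pcomp ?P (E u) i y \<in> ?S" if u: "u \<in> {w \<in> cliffs \<delta>. cliff_size w = n}" for u
      using \<open>y \<in> component ?P m\<close>[unfolded component_Cl mem_Collect_eq]
    proof (induction rule: cliff_span_induct)
      case (E w c)
      then show ?case
        unfolding pcomp_Cl_scale_right pcomp_Cl_E by (intro scl basis u)
    qed (auto simp only: bilinear pcomp_Cl_zero intro: zero add)
    show ?thesis
      using \<open>x \<in> component ?P n\<close>[unfolded component_Cl mem_Collect_eq]
    proof (induction rule: cliff_span_induct)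
      case (E w c)
      then show ?case
        unfolding pcomp_Cl_scale_left by (intro scl y)
    qed (auto simp only: bilinear pcomp_Cl_zero intro: zero add)
  qed
  show "pcomp ?P (op_unit ?P) 1 x = x" if "x \<in> component ?P n"
    using that[unfolded component_Cl mem_Collect_eq]
    by (induction rule: cliff_span_induct)
      (auto simp: bilinear pcomp_Cl_E cliff_comp_basis_def word_insert_def)
  show "pcomp ?P x i (op_unit ?P) = x" if "x \<in> component ?P n" "1 \<le> i" "i \<le> n"
    using that(1)[unfolded component_Cl mem_Collect_eq]
    by (induction rule: cliff_span_induct)
      (auto simp: bilinear pcomp_Cl_E cliff_comp_basis_def word_insert_def)
  show "pcomp ?P (pcomp ?P x i y) (i + j - 1) z = pcomp ?P x i (pcomp ?P y j z)"
    if "x \<in> component ?P n" "y \<in> component ?P m" "z \<in> component ?P p"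
      "1 \<le> i" "i \<le> n" "1 \<le> j" "j \<le> m"
  proof -
    have z: "pcomp ?P (pcomp ?P (E u) i (E v)) (i + j - 1) z = pcomp ?P (E u) i (pcomp ?P (E v) j z)"
      if "u \<in> {w \<in> cliffs \<delta>. cliff_size w = n}" "v \<in> {w \<in> cliffs \<delta>. cliff_size w = m}" for u v
      using \<open>z \<in> component ?P p\<close>[unfolded component_Cl mem_Collect_eq]
    proof (induction rule: cliff_span_induct)
      case (E w c)
      then show ?case
        using assoc_nested_basis[where 'k = 'k, OF assms, of u v w i j] that \<open>1 \<le> i\<close> \<open>i \<le> n\<close> \<open>1 \<le> j\<close> \<open>j \<le> m\<close>
        by (simp add: bilinear pcomp_Cl_E)
    qed (simp_all only: bilinear pcomp_Cl_zero)
    have y: "pcomp ?P (pcomp ?P (E u) i y) (i + j - 1) z = pcomp ?P (E u) i (pcomp ?P y j z)"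
      if "u \<in> {w \<in> cliffs \<delta>. cliff_size w = n}" for u
      using \<open>y \<in> component ?P m\<close>[unfolded component_Cl mem_Collect_eq]
      by (induction rule: cliff_span_induct) (simp_all only: bilinear pcomp_Cl_zero z that)
    show ?thesis
      using \<open>x \<in> component ?P n\<close>[unfolded component_Cl mem_Collect_eq]
      by (induction rule: cliff_span_induct) (simp_all only: bilinear pcomp_Cl_zero y)
  qed
  show "pcomp ?P (pcomp ?P x i y) (j + m - 1) z = pcomp ?P (pcomp ?P x j z) i y"
    if "x \<in> component ?P n" "y \<in> component ?P m" "z \<in> component ?P p" "1 \<le> i" "i < j" "j \<le> n"
  proof -
    have z: "pcomp ?P (pcomp ?P (E u) i (E v)) (j + m - 1) z = pcomp ?P (pcomp ?P (E u) j z) i (E v)"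
      if "u \<in> {w \<in> cliffs \<delta>. cliff_size w = n}" "v \<in> {w \<in> cliffs \<delta>. cliff_size w = m}" for u v
      using \<open>z \<in> component ?P p\<close>[unfolded component_Cl mem_Collect_eq]
    proof (induction rule: cliff_span_induct)
      case (E w c)
      then show ?case
        using assoc_disjoint_basis[where 'k = 'k, OF assms, of u v w i j] that \<open>1 \<le> i\<close> \<open>i < j\<close> \<open>j \<le> n\<close>
        by (auto simp: bilinear pcomp_Cl_E)
    qed (simp_all only: bilinear pcomp_Cl_zero)
    have y: "pcomp ?P (pcomp ?P (E u) i y) (j + m - 1) z = pcomp ?P (pcomp ?P (E u) j z) i y"
      if "u \<in> {w \<in> cliffs \<delta>. cliff_size w = n}" for u
      using \<open>y \<in> component ?P m\<close>[unfolded component_Cl mem_Collect_eq]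
      by (induction rule: cliff_span_induct) (simp_all only: bilinear pcomp_Cl_zero z that)
    show ?thesis
      using \<open>x \<in> component ?P n\<close>[unfolded component_Cl mem_Collect_eq]
      by (induction rule: cliff_span_induct) (simp_all only: bilinear pcomp_Cl_zero y)
  qed
qed

end

theory Submission
  imports Defs
begin

text \<open>A word that is not prime is a composition of two strictly shorter nonempty cliffs, so the
  primes generate; and the coefficient at a prime \<open>w\<close> of a composition only involves the
  coefficients at \<open>w\<close> of the two arguments, so \<open>E w\<close> cannot be obtained from other
  basis elements.

  If \<open>\<delta> j \<le> \<delta> 1\<close> for all \<open>j \<ge> k\<close>, then the last letter of a cliff of length
  \<open>\<ge> max k 2\<close> is itself a cliff and splits off, so primes have bounded length. Otherwise,
  unimodality forces \<open>\<delta>\<close> to be constant, equal to some \<open>c\<close>, on an initial segment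
  \<open>{1..a}\<close>, and greater than \<open>c\<close> afterwards. The words \<open>c\<^sup>a (c + 1)\<^sup>r\<close> with
  \<open>r \<ge> 1\<close> are then all prime: in a composition, some letter \<open>c + 1\<close> of one of the two
  factors would stand at a position at most \<open>a\<close>.\<close>

section \<open>The minimal generating set\<close>

text \<open>Only the rule \<open>gen\<close> of \<open>generated\<close> mentions components; for
  the others the closure axioms of an operad supply the arity.\<close>

lemma (in ns_operad) generated_in_component:
  assumes "generated P S n x"
  shows "x \<in> component P n"
proof -
  interpret vs: vector_space "scale P" by (rule vector_space)
  show ?thesis
    using assms
    by induction
      (blast intro: unit_closed pcomp_closed vs.subspace_0 vs.subspace_add vs.subspace_scale
        component_subspace)+
qed

lemma lookup_pcomp_Cl_nonzero:
  fixes x y :: "nat list \<Rightarrow>\<^sub>0 'k::field_char_0"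
  assumes "Poly_Mapping.lookup (pcomp (Cl \<delta>) x i y) w \<noteq> 0"
  obtains u v where "u \<in> Poly_Mapping.keys x" "v \<in> Poly_Mapping.keys y" "w = word_insert u i v"
proof -
  have "(\<Sum>u\<in>Poly_Mapping.keys x. \<Sum>v\<in>Poly_Mapping.keys y.
      Poly_Mapping.lookup x u * Poly_Mapping.lookup y v *
      Poly_Mapping.lookup (cliff_comp_basis \<delta> u i v :: nat list \<Rightarrow>\<^sub>0 'k) w) \<noteq> 0"
    using assms by (simp add: Cl_def lookup_sum)
  then obtain u where u: "u \<in> Poly_Mapping.keys x" "(\<Sum>v\<in>Poly_Mapping.keys y.
      Poly_Mapping.lookup x u * Poly_Mapping.lookup y v *
      Poly_Mapping.lookup (cliff_comp_basis \<delta> u i v :: nat list \<Rightarrow>\<^sub>0 'k) w) \<noteq> 0"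
    by (rule sum.not_neutral_contains_not_neutral)
  from u(2) obtain v where v: "v \<in> Poly_Mapping.keys y" "Poly_Mapping.lookup x u *
      Poly_Mapping.lookup y v *
      Poly_Mapping.lookup (cliff_comp_basis \<delta> u i v :: nat list \<Rightarrow>\<^sub>0 'k) w \<noteq> 0"
    by (rule sum.not_neutral_contains_not_neutral)
  from v(2) have "w = word_insert u i v"
    by (auto simp: cliff_comp_basis_def E_def lookup_single when_def split: if_splits)
  with u(1) v(1) show ?thesis by (rule that)
qed

text \<open>For a prime \<open>w\<close>, vanishing of the coefficient at \<open>w\<close> is
  preserved by all operations of the operad. Minimality uses this with \<open>T\<close> a set of
  generators that misses \<open>E w\<close>.\<close>

lemma lookup_generated_prime:
  fixes x :: "nat list \<Rightarrow>\<^sub>0 'k::field_char_0"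
  assumes "unimodal \<delta>" "w \<in> primes \<delta>" "\<And>t. t \<in> T \<Longrightarrow> Poly_Mapping.lookup t w = 0"
    and "generated (Cl \<delta>) T n x"
  shows "Poly_Mapping.lookup x w = 0"
  using assms(4)
proof induction
  case unit
  have "w \<noteq> []" using assms(2) by (simp add: primes_def)
  then show ?case by (simp add: E_def lookup_single when_def)
next
  case (pcomp n x m y i)
  have x: "x \<in> component (Cl \<delta>) n" and y: "y \<in> component (Cl \<delta>) m"
    using ns_operad.generated_in_component[OF ns_operad_Cl[OF assms(1)]] pcomp.hyps by blast+
  show ?case
  proof (rule ccontr)
    assume "Poly_Mapping.lookup (pcomp (Cl \<delta>) x i y) w \<noteq> 0"
    then obtain u v where uv: "u \<in> Poly_Mapping.keys x" "v \<in> Poly_Mapping.keys y"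
      "w = word_insert u i v"
      by (rule lookup_pcomp_Cl_nonzero)
    \<comment> \<open>All keys of \<open>x\<close> have size \<open>n\<close>, so the bound on
      \<open>i\<close> holds for \<open>u\<close>, and primality of \<open>w\<close>
      applies.\<close>
    have "u \<in> cliffs \<delta>" "v \<in> cliffs \<delta>" "i \<le> cliff_size u"
      using x y uv \<open>i \<le> n\<close> by auto
    then have "u = w \<or> v = w"
      using assms(2) uv(3) \<open>1 \<le> i\<close> unfolding primes_def by blast
    then show False
      using uv pcomp.IH by (auto simp: in_keys_iff)
  qed
qed (use assms(3) in \<open>auto simp: lookup_add\<close>)

text \<open>If one factor were empty, the other would be \<open>w\<close>, giving an excluded pair.
  So both are nonempty, and since lengths add up, both are shorter than \<open>w\<close>.\<close>

lemma not_prime_decomposition: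
  assumes "w \<in> cliffs \<delta>" "w \<noteq> []" "w \<notin> primes \<delta>"
  obtains u v i where "u \<in> cliffs \<delta>" "v \<in> cliffs \<delta>" "1 \<le> i" "i \<le> cliff_size u"
    "w = word_insert u i v" "length u < length w" "length v < length w"
proof -
  obtain u v i where *: "u \<in> cliffs \<delta>" "v \<in> cliffs \<delta>" "1 \<le> i" "i \<le> cliff_size u"
    "w = word_insert u i v" "(u, v) \<noteq> (w, [])" "(u, v) \<noteq> ([], w)"
    using assms unfolding primes_def by blast
  then have "u \<noteq> []" "v \<noteq> []"
    by (auto simp: word_insert_def)
  moreover have "length w = length u + length v"
    using *(4,5) by (auto simp: word_insert_def cliff_size_def)
  ultimately show ?thesis
    using that * by simp
qed

lemma generated_E:
  assumes "w \<in> cliffs \<delta>"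
  shows "generated (Cl \<delta>) (\<GG> \<delta>) (cliff_size w) (E w :: nat list \<Rightarrow>\<^sub>0 'k::field_char_0)"
  using assms
proof (induction w rule: length_induct)
  case (1 w)
  consider "w = []" | "w \<in> primes \<delta>" | "w \<noteq> []" "w \<notin> primes \<delta>"
    by blast
  then show ?case
  proof cases
    case 1
    then show ?thesis
      using generated.unit[of "Cl \<delta>" "\<GG> \<delta>"] by (simp add: cliff_size_def)
  next
    case 2
    then show ?thesis
      using "1.prems" by (intro generated.gen) (auto simp: \<GG>_def)
  next
    case 3
    then obtain u v i where *: "u \<in> cliffs \<delta>" "v \<in> cliffs \<delta>" "1 \<le> i" "i \<le> cliff_size u"
      "w = word_insert u i v" "length u < length w" "length v < length w"
      using "1.prems" not_prime_decomposition by blast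
    have "generated (Cl \<delta>) (\<GG> \<delta>) (cliff_size u + cliff_size v - 1)
        (pcomp (Cl \<delta>) (E u :: nat list \<Rightarrow>\<^sub>0 'k) i (E v))"
      using * "1.IH" by (intro generated.pcomp) auto
    \<comment> \<open>The composition is not 0, because the word it produces is the cliff
      \<open>w\<close>.\<close>
    moreover have "pcomp (Cl \<delta>) (E u :: nat list \<Rightarrow>\<^sub>0 'k) i (E v) = E w"
      using * "1.prems" by (simp add: pcomp_Cl_E cliff_comp_basis_def)
    moreover have "cliff_size w = cliff_size u + cliff_size v - 1"
      using *(4,5) by (auto simp: word_insert_def cliff_size_def)
    ultimately show ?thesis by simp
  qed
qed

lemma generates_primes:
  assumes "unimodal \<delta>"
  shows "generates (Cl \<delta>) (\<GG> \<delta> :: (nat list \<Rightarrow>\<^sub>0 'k::field_char_0) set)"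
  unfolding generates_def
proof (intro conjI allI)
  show "\<GG> \<delta> \<subseteq> (\<Union>n. component (Cl \<delta>) n)"
    by (auto simp: \<GG>_def primes_def)
  fix n
  let ?G = "generated (Cl \<delta>) (\<GG> \<delta> :: (nat list \<Rightarrow>\<^sub>0 'k) set) n"
  have "?G x" if "x \<in> component (Cl \<delta>) n" for x
    using that[unfolded component_Cl mem_Collect_eq]
  proof (induction rule: cliff_span_induct)
    case (E w c)
    then show ?case
      using generated.scale[OF generated_E[of w \<delta>], of c] by auto
  qed (auto intro: generated.zero generated.add)
  then show "{x. ?G x} = component (Cl \<delta>) n"
    using ns_operad.generated_in_component[OF ns_operad_Cl[OF assms]] by blast
qed

lemma minimal_generating_set_primes:
  assumes "unimodal \<delta>"
  shows "minimal_generating_set (Cl \<delta>) (\<GG> \<delta> :: (nat list \<Rightarrow>\<^sub>0 'k::field_char_0) set)"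
  unfolding minimal_generating_set_def
proof (intro conjI allI impI notI generates_primes assms)
  fix T :: "(nat list \<Rightarrow>\<^sub>0 'k) set"
  assume T: "T \<subset> \<GG> \<delta>" and gen: "generates (Cl \<delta>) T"
  then obtain w where w: "w \<in> primes \<delta>" "(E w :: nat list \<Rightarrow>\<^sub>0 'k) \<notin> T"
    by (auto simp: \<GG>_def)
  have "Poly_Mapping.lookup t w = 0" if "t \<in> T" for t
  proof -
    obtain p where "t = E p" using T \<open>t \<in> T\<close> unfolding \<GG>_def by blast
    with w(2) that show ?thesis by (auto simp: E_def lookup_single when_def)
  qed
  moreover have "generated (Cl \<delta>) T (cliff_size w) (E w)"
  proof -
    have "(E w :: nat list \<Rightarrow>\<^sub>0 'k) \<in> component (Cl \<delta>) (cliff_size w)"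
      using w(1) by (auto simp: primes_def)
    then show ?thesis
      using gen unfolding generates_def by blast
  qed
  ultimately have "Poly_Mapping.lookup (E w :: nat list \<Rightarrow>\<^sub>0 'k) w = 0"
    using lookup_generated_prime[OF assms w(1)] by blast
  then show False by (simp add: E_def)
qed

lemma finite_\<GG>_iff: "finite (\<GG> \<delta> :: (nat list \<Rightarrow>\<^sub>0 'k::field_char_0) set) \<longleftrightarrow> finite (primes \<delta>)"
proof -
  have "inj_on (E :: _ \<Rightarrow> nat list \<Rightarrow>\<^sub>0 'k) (primes \<delta>)"
    by (rule inj_onI) (metis keys_E singleton_inject)
  then show ?thesis
    unfolding \<GG>_def by (rule finite_image_iff)
qed

section \<open>Finiteness of the set of primes\<close>

lemma finite_cliffs_bounded: "finite {w \<in> cliffs \<delta>. length w \<le> n}"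
proof (rule finite_subset)
  show "{w \<in> cliffs \<delta>. length w \<le> n} \<subseteq> {w. set w \<subseteq> {..Max (\<delta> ` {..n})} \<and> length w \<le> n}"
  proof clarsimp
    fix w x
    assume w: "w \<in> cliffs \<delta>" "length w \<le> n" "x \<in> set w"
    then obtain k where k: "k < length w" "x = w ! k"
      by (auto simp: in_set_conv_nth)
    then have "x \<le> \<delta> (Suc k)"
      using w(1) by (auto simp: cliffs_iff_fits fits_def)
    also have "\<dots> \<le> Max (\<delta> ` {..n})"
      using k w(2) by (intro Max_ge) auto
    finally show "x \<le> Max (\<delta> ` {..n})" .
  qed
qed (auto intro: finite_lists_length_le)

lemma length_prime_less:
  assumes "\<And>j. j \<ge> k \<Longrightarrow> \<delta> j \<le> \<delta> 1" "w \<in> primes \<delta>"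
  shows "length w < max k 2"
proof (rule ccontr)
  \<comment> \<open>Length at least 2 leaves a nonempty word once the last letter is removed; length
    at least \<open>k\<close> bounds that letter by \<open>\<delta> 1\<close>.\<close>
  assume len: "\<not> length w < max k 2"
  then have "2 \<le> length w" by simp
  then obtain u x where w: "w = u @ [x]" and u: "u \<noteq> []"
    by (cases w rule: rev_cases) force+
  have "w \<in> cliffs \<delta>" using assms(2) by (simp add: primes_def)
  then have "u \<in> cliffs \<delta>" "x \<le> \<delta> (length w)"
    unfolding w by (auto simp: cliffs_iff_fits fits_def[of _ _ "[x]"])
  moreover from this have "[x] \<in> cliffs \<delta>"
    using assms(1)[of "length w"] len by (simp add: cliffs_iff_fits fits_def not_less)
  moreover have "w = word_insert u (length u + 1) [x]"
    using w by (simp add: word_insert_def)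
  ultimately have "(u, [x]) \<in> {(w, []), ([], w)}"
    using assms(2) unfolding primes_def cliff_size_def by fastforce
  with u show False by simp
qed

lemma finite_primes:
  assumes "one_dominated \<delta>"
  shows "finite (primes \<delta>)"
proof -
  obtain k where "\<And>j. j \<ge> k \<Longrightarrow> \<delta> j \<le> \<delta> 1"
    using assms by (auto simp: one_dominated_def)
  then have "length w \<le> max k 2" if "w \<in> primes \<delta>" for w
    using length_prime_less that less_imp_le by blast
  then have "primes \<delta> \<subseteq> {w \<in> cliffs \<delta>. length w \<le> max k 2}"
    by (auto simp: primes_def)
  then show ?thesis
    using finite_cliffs_bounded finite_subset by blast
qed

text \<open>Values above \<open>\<delta> 1\<close> occur arbitrarily late. A value below
  \<open>\<delta> 1\<close>, or a return to \<open>\<delta> 1\<close> after a larger value, would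
  therefore form a valley. The witness \<open>a\<close> is the position just before the first value
  above \<open>\<delta> 1\<close>.\<close>

lemma not_one_dominated_shape:
  assumes "unimodal \<delta>" "\<not> one_dominated \<delta>"
  obtains a where "1 \<le> a" "\<And>i. 1 \<le> i \<Longrightarrow> i \<le> a \<Longrightarrow> \<delta> i = \<delta> 1" "\<And>i. a < i \<Longrightarrow> \<delta> 1 < \<delta> i"
proof -
  have large: "\<exists>j>k. \<delta> 1 < \<delta> j" for k
    using assms(2) unfolding one_dominated_def
    by (metis Suc_le_eq le_add1 not_le plus_1_eq_Suc)
  have uni: "\<delta> i \<le> \<delta> j \<or> \<delta> k \<le> \<delta> j" if "1 \<le> i" "i < j" "j < k" for i j k
    using assms(1) that unfolding unimodal_def by (meson not_le)
  have ge: "\<delta> 1 \<le> \<delta> i" if "1 \<le> i" for i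
    using uni[of 1 i] large[of i] that by (metis le_less le_trans not_le)
  define m where "m = (LEAST m. 1 \<le> m \<and> \<delta> 1 < \<delta> m)"
  have "\<exists>m. 1 \<le> m \<and> \<delta> 1 < \<delta> m"
    using large[of 1] less_imp_le by blast
  then have m: "1 \<le> m" "\<delta> 1 < \<delta> m"
    unfolding m_def using LeastI_ex[of "\<lambda>m. 1 \<le> m \<and> \<delta> 1 < \<delta> m"] by auto
  have least: "\<delta> i \<le> \<delta> 1" if "1 \<le> i" "i < m" for i
    using that not_less_Least[of i "\<lambda>m. 1 \<le> m \<and> \<delta> 1 < \<delta> m"] unfolding m_def by auto
  have "m \<noteq> 1" using m(2) by auto
  show ?thesis
  proof (rule that[of "m - 1"])
    show "1 \<le> m - 1" using m(1) \<open>m \<noteq> 1\<close> by simp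
    show "\<delta> i = \<delta> 1" if "1 \<le> i" "i \<le> m - 1" for i
      using ge[of i] least[of i] that by simp
    show "\<delta> 1 < \<delta> i" if "m - 1 < i" for i
    proof (cases "i = m")
      case False
      obtain j where "i < j" "\<delta> 1 < \<delta> j" using large by blast
      \<comment> \<open>By unimodality \<open>\<delta> i\<close> is at least
        \<open>\<delta> m\<close> or at least \<open>\<delta> j\<close>, and both exceed
        \<open>\<delta> 1\<close>.\<close>
      then show ?thesis
        using uni[of m i j] m that False by fastforce
    qed (use m in simp)
  qed
qed

lemma step_word_prime:
  assumes "1 \<le> a" "\<And>i. 1 \<le> i \<Longrightarrow> i \<le> a \<Longrightarrow> \<delta> i = \<delta> 1" "\<And>i. a < i \<Longrightarrow> \<delta> 1 < \<delta> i" "1 \<le> r"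
  shows "replicate a (\<delta> 1) @ replicate r (Suc (\<delta> 1)) \<in> primes \<delta>" (is "?w \<in> _")
proof -
  have high: "?w ! k = Suc (\<delta> 1)" if "a \<le> k" "k < a + r" for k
    using that by (simp add: nth_append)
  have low: "z ! k \<le> \<delta> 1" if "z \<in> cliffs \<delta>" "k < length z" "k < a" for z k
    using that assms(2)[of "Suc k"] by (auto simp: cliffs_iff_fits fits_def)
  have cliff: "?w \<in> cliffs \<delta>"
    unfolding cliffs_iff_fits fits_append unfolding fits_def
  proof (intro conjI allI impI)
    show "replicate a (\<delta> 1) ! k \<le> \<delta> (0 + k + 1)" if "k < length (replicate a (\<delta> 1))" for k
      using assms(2)[of "k + 1"] that by simp
    show "replicate r (Suc (\<delta> 1)) ! k \<le> \<delta> (0 + length (replicate a (\<delta> 1)) + k + 1)"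
      if "k < length (replicate r (Suc (\<delta> 1)))" for k
      using assms(3)[of "a + k + 1"] that by simp
  qed
  have empty: "u = [] \<or> v = []"
    if uv: "u \<in> cliffs \<delta>" "v \<in> cliffs \<delta>" "1 \<le> i" "i \<le> cliff_size u" "?w = word_insert u i v"
    for u v i
  proof (rule ccontr)
    assume ne: "\<not> (u = [] \<or> v = [])"
    obtain u1 u2 where u: "u = u1 @ u2" "i = length u1 + 1"
      using word_insert_split uv(3,4) by blast
    have w: "?w = u1 @ v @ u2"
      using uv(5) u by simp
    have len: "a + r = length u1 + length v + length u2"
      using arg_cong[OF w, of length] by simp
    \<comment> \<open>Otherwise \<open>v\<close> would begin with \<open>Suc (\<delta> 1)\<close>,
      too large for the first letter of a cliff.\<close>
    have v0: "\<not> a \<le> length u1"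
      using high[of "length u1"] low[OF uv(2), of 0] ne len assms(1)
      unfolding w by (cases v) (auto simp: nth_append)
    show False
    proof (cases "a < length u1 + length v")
      case True
      \<comment> \<open>Here \<open>v\<close> covers index \<open>a\<close> of the word. A nonempty
        \<open>u1\<close> would shift this large letter to an index below \<open>a\<close> in
        \<open>v\<close>; hence \<open>u1\<close> is empty, and \<open>u\<close> starts beyond index
        \<open>a\<close>, with a large letter.\<close>
      then have va: "v ! (a - length u1) = Suc (\<delta> 1)"
        using high[of a] v0 assms(4) unfolding w
        by (simp add: nth_append less_diff_conv2 split: if_splits)
      have "u1 = []"
        using low[OF uv(2), of "a - length u1"] va v0 True
        by (cases u1) (auto simp: less_diff_conv2)
      then have "u ! 0 = Suc (\<delta> 1)"
        using high[of "length v"] True len ne u unfolding w by (simp add: nth_append)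
      then show False
        using low[OF uv(1), of 0] ne assms(1) by simp
    next
      case False
      \<comment> \<open>Here \<open>v\<close> ends at or before index \<open>a\<close>, so the
        letter at \<open>a\<close> comes from \<open>u2\<close>. Removing the nonempty
        \<open>v\<close> moves it to an index below \<open>a\<close> in \<open>u\<close>.\<close>
      have "u ! (a - length v) = Suc (\<delta> 1)"
        using high[of a] False v0 assms(4) unfolding w u
        by (auto simp: nth_append less_diff_conv2 add.commute split: if_splits)
      moreover have "a - length v < length u" "a - length v < a"
        using False len ne u assms(1,4) by auto
      ultimately show False
        using low[OF uv(1), of "a - length v"] by simp
    qed
  qed
  have "(u, v) \<in> {(?w, []), ([], ?w)}"
    if "u \<in> cliffs \<delta>" "v \<in> cliffs \<delta>" "1 \<le> i" "i \<le> cliff_size u" "?w = word_insert u i v"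
    for u v i
    using empty[OF that] unfolding that(5) by (auto simp: word_insert_def)
  moreover have "?w \<noteq> []" using assms(1) by simp
  ultimately show ?thesis
    using cliff unfolding primes_def by blast
qed

lemma infinite_primes:
  assumes "unimodal \<delta>" "\<not> one_dominated \<delta>"
  shows "infinite (primes \<delta>)"
proof -
  obtain a where a: "1 \<le> a" "\<And>i. 1 \<le> i \<Longrightarrow> i \<le> a \<Longrightarrow> \<delta> i = \<delta> 1" "\<And>i. a < i \<Longrightarrow> \<delta> 1 < \<delta> i"
    using not_one_dominated_shape[OF assms] by blast
  \<comment> \<open>\<open>Suc r\<close> ensures at least one large letter; the words are distinct
    because their lengths are.\<close>
  let ?w = "\<lambda>r. replicate a (\<delta> 1) @ replicate (Suc r) (Suc (\<delta> 1))"
  have "inj ?w"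
    by (rule injI) (metis add_left_cancel length_append length_replicate Suc_inject)
  moreover have "range ?w \<subseteq> primes \<delta>"
  proof (intro image_subsetI step_word_prime)
    show "1 \<le> Suc r" for r by simp
  qed (rule a; assumption)+
  ultimately show ?thesis
    using finite_subset finite_imageD infinite_UNIV_nat by blast
qed

theorem theorem2p3p3:
  fixes \<delta> :: "nat \<Rightarrow> nat"
  assumes "unimodal \<delta>"
  shows "minimal_generating_set (Cl \<delta>) (\<GG> \<delta> :: (nat list \<Rightarrow>\<^sub>0 'k::field_char_0) set) \<and>
    (finite (\<GG> \<delta> :: (nat list \<Rightarrow>\<^sub>0 'k) set) \<longleftrightarrow> one_dominated \<delta>)"
  using minimal_generating_set_primes[OF assms] finite_primes infinite_primes[OF assms] finite_\<GG>_iff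
  by blast

end
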